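(* Let $R>0$, let $\theta$ be a monotone property and $\ell$ a loss satisfying the assumptions listed in the context with constants $B$ and $L$, and let $\beta>0$. Set $c_\varepsilon=128\log\!\big(6RB/(L\beta^2)\big)$. For any $\varepsilon\in(0,c_\varepsilon^{-1})$ there exists a $(c_\varepsilon\cdot\varepsilon)$-differentially private algorithm $A$ such that for every dataset $D\subset[-R,R]$, $$\mathbb{E}\big[\ell(A(D),\theta(D))\big]\le 2e^2\,R(D,\varepsilon)+7L\beta .$$
   Context: Datasets are finite multisets of points of $[-R,R]$; $|D|$ is cardinality with multiplicity. $d(D,D')=|D\setminus D'|+|D'\setminus D|$ (multiset differences), and $D,D'$ are neighboring if $d(D,D')=1$. A randomized algorithm $A$ is $\varepsilon$-differentially private ($\varepsilon$-DP) if $\Pr[A(D)\in S]\le e^{\varepsilon}\Pr[A(D')\in S]$ for all neighboring $D,D'$ and all (measurable) output sets $S$; $\mathcal{A}_\varepsilon$ is the set of all $\varepsilon$-DP algorithms. Subset-based risk (here $R(\cdot,\cdot)$ is the risk, while $R$ alone is the range): $$R(D,\varepsilon)=\inf_{A\in\mathcal{A}_\varepsilon}\ \sup_{D'\subseteq D,\ |D'|\ge|D|-1/\varepsilon}\mathbb{E}\big[\ell(A(D'),\theta(D'))\big].$$ Only $\varepsilon\le1$ is considered, and $1/\varepsilon$ is treated as a positive integer. Stochastic dominance: for finite multisets of reals, $D'\succ D$ if for all $v\in\mathbb{R}$, $\frac{1}{|D'|}\sum_{x'\in D'}\mathbf{1}\{x'\le v\}\le\frac{1}{|D|}\sum_{x\in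 D}\mathbf{1}\{x\le v\}$. A property $\theta$ (a real-valued function of datasets) is monotone if either $\theta(D')\ge\theta(D)$ for all $D',D$ with $D'\succ D$, or $\theta(D')\le\theta(D)$ for all $D',D$ with $D'\succ D$. Assumptions on $\theta$ and the nonnegative loss $\ell$ on pairs of reals: (1) $\theta(D)\in[-R,R]$ for every dataset $D$ supported on $[-R,R]$. (2) $\ell$ is a metric: it is symmetric, satisfies the triangle inequality, and $\ell(\theta,\theta)=0$. (3) $\ell$ is finite and bounded: $B=\sup_{D,D'}\ell(\theta(D),\theta(D'))<\infty$. (4) Whenever $\theta\ge\theta_1\ge\theta_2$ (reals), $\ell(\theta,\theta_1)\le\ell(\theta,\theta_2)$. (5) $\ell$ is $L$-Lipschitz: (a) for all $D,D'$ with $|D|=|D'|$, $\ell(\theta(D),\theta(D'))\le L\max_{i\le|D|}|x_i(D)-x_i(D')|$, where $x_i(D)$ is the $i$-th largest element of $D$; (b) for all reals $\theta$ and $\theta_1\ne\theta_2$, $\ell(\theta,\theta_1)\le\ell(\theta,\theta_2)+L|\theta_1-\theta_2|$. *)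

theory Defs
  imports "HOL-Probability.Probability" "HOL-Library.Multiset"
begin

definition datasets :: "real \<Rightarrow> real multiset set" where
  "datasets R = {D. set_mset D \<subseteq> {-R..R}}"

definition mset_dist :: "'a multiset \<Rightarrow> 'a multiset \<Rightarrow> nat" where
  "mset_dist D D' = size (D - D') + size (D' - D)"

definition neighboring :: "'a multiset \<Rightarrow> 'a multiset \<Rightarrow> bool" where
  "neighboring D D' \<longleftrightarrow> mset_dist D D' = 1"

(* A randomized real-valued algorithm assigns to each dataset the law of its output,
   a Borel probability measure on the reals; its values outside datasets R are irrelevant. *)
definition dp_algorithms :: "real \<Rightarrow> real \<Rightarrow> (real multiset \<Rightarrow> real measure) set" where
  "dp_algorithms R \<epsilon> =
    {A. (\<forall>D\<in>datasets R. prob_space (A D) \<and> sets (A D) = sets borel) \<and>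
        (\<forall>D\<in>datasets R. \<forall>D'\<in>datasets R. neighboring D D' \<longrightarrow>
           (\<forall>S\<in>sets borel. measure (A D) S \<le> exp \<epsilon> * measure (A D') S))}"

(* Losses are nonnegative and possibly unbounded off the range of the property, so the
   expectation is taken in [0, \<infinity>]. *)
definition expected_loss ::
  "(real \<Rightarrow> real \<Rightarrow> real) \<Rightarrow> (real multiset \<Rightarrow> real) \<Rightarrow> (real multiset \<Rightarrow> real measure) \<Rightarrow>
   real multiset \<Rightarrow> ennreal" where
  "expected_loss loss \<theta> A D = (\<integral>\<^sup>+ y. ennreal (loss y (\<theta> D)) \<partial>A D)"

definition subset_risk ::
  "real \<Rightarrow> (real \<Rightarrow> real \<Rightarrow> real) \<Rightarrow> (real multiset \<Rightarrow> real) \<Rightarrow>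
   real multiset \<Rightarrow> real \<Rightarrow> ennreal" where
  "subset_risk R loss \<theta> D \<epsilon> =
    (INF A\<in>dp_algorithms R \<epsilon>.
       SUP D'\<in>{D'. D' \<subseteq># D \<and> real (size D') \<ge> real (size D) - 1 / \<epsilon>}.
         expected_loss loss \<theta> A D')"

(* The empirical distribution function exists only for nonempty multisets, so the empty one is
   not related to anything; without this restriction, division by zero would make it
   dominate every multiset. *)
definition stoch_dominates :: "real multiset \<Rightarrow> real multiset \<Rightarrow> bool" where
  "stoch_dominates D' D \<longleftrightarrow> D' \<noteq> {#} \<and> D \<noteq> {#} \<and>
    (\<forall>v::real. real (size {#x \<in># D'. x \<le> v#}) / real (size D')
           \<le> real (size {#x \<in># D. x \<le> v#}) / real (size D))"

definition monotone_property :: "real \<Rightarrow> (real multiset \<Rightarrow> real) \<Rightarrow> bool" where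
  "monotone_property R \<theta> \<longleftrightarrow>
    (\<forall>D'\<in>datasets R. \<forall>D\<in>datasets R. stoch_dominates D' D \<longrightarrow> \<theta> D' \<ge> \<theta> D) \<or>
    (\<forall>D'\<in>datasets R. \<forall>D\<in>datasets R. stoch_dominates D' D \<longrightarrow> \<theta> D' \<le> \<theta> D)"

(* For 1 \<le> i \<le> size D, the i-th largest element of D, counted with multiplicity. *)
definition ith_largest :: "real multiset \<Rightarrow> nat \<Rightarrow> real" where
  "ith_largest D i = rev (sorted_list_of_multiset D) ! (i - 1)"

end

theory Submission
  imports Defs
begin

text \<open>Let \<open>W\<close> be about \<open>1 / (4 \<epsilon>)\<close> and let \<open>h D\<close> be \<open>\<theta>\<close> of \<open>D\<close> with its \<open>W\<close> least and \<open>W\<close> greatest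
  points removed (\<open>\<theta>\<close> of the empty dataset if \<open>D\<close> is small). The algorithm is the exponential mechanism
  on the values of \<open>h\<close> rounded to multiples of \<open>\<beta>\<close>, where a value \<open>t\<close> is scored by the number of edits
  of \<open>D\<close> needed to reach a dataset whose rounded value is \<open>t\<close>. With overwhelming probability at most
  \<open>W\<close> edits are used, and by monotonicity the output then lies, up to \<open>\<beta>\<close>, between the values of \<open>\<theta>\<close> at
  \<open>D\<close> without its \<open>2 W\<close> greatest and without its \<open>2 W\<close> least points. Conversely, an \<open>\<epsilon>\<close>-private
  algorithm cannot tell \<open>D\<close> from a subset \<open>E\<close> with at most \<open>1 / \<epsilon>\<close> points fewer by more than a factor
  \<open>e\<close>, so the loss between \<open>\<theta> E\<close> and \<open>\<theta> D\<close> is at most \<open>2 e\<close> times the subset risk. The loss of an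
  intermediate value is at most twice that of the extremes, and \<open>4 e \<le> 2 e\<^sup>2\<close>.\<close>

section \<open>Distances and trimmed datasets\<close>

lemma mset_dist_commute: "mset_dist D D' = mset_dist D' D"
  by (simp add: mset_dist_def)

lemma mset_dist_triangle: "mset_dist A C \<le> mset_dist A B + mset_dist B C"
proof -
  have *: "size (A - C) \<le> size (A - B) + size (B - C)" for A B C :: "'a multiset"
  proof -
    have "A - C \<subseteq># (A - B) + (B - C)"
      unfolding subseteq_mset_def by (simp, linarith)
    then show ?thesis
      by (metis size_mset_mono size_union)
  qed
  from *[of A C B] *[of C A B] show ?thesis
    by (simp add: mset_dist_def)
qed

text \<open>Both sides are the size of the pointwise maximum of the two multisets.\<close>

lemma size_add_diff_swap:
  fixes D D' :: "'a multiset"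
  shows "size D + size (D' - D) = size D' + size (D - D')"
proof -
  have "D + (D' - D) = D' + (D - D')"
    by (rule multiset_eqI) simp
  then show ?thesis
    by (metis size_union)
qed

lemma size_filter_mset_le_diff:
  "size (filter_mset P D) \<le> size (filter_mset P D') + size (D - D')"
proof -
  have "D \<subseteq># D' + (D - D')"
    unfolding subseteq_mset_def by (simp, linarith)
  then have "size (filter_mset P D) \<le> size (filter_mset P D') + size (filter_mset P (D - D'))"
    by (metis filter_union_mset multiset_filter_mono size_mset_mono size_union)
  also have "\<dots> \<le> size (filter_mset P D') + size (D - D')"
    by (intro add_left_mono size_mset_mono multiset_filter_subset)
  finally show ?thesis .
qed

section \<open>Slices of the sorted dataset and their counting functions\<close>

definition slice :: "nat \<Rightarrow> nat \<Rightarrow> 'a::linorder multiset \<Rightarrow> 'a multiset" where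
  "slice a b D = mset (drop a (take b (sorted_list_of_multiset D)))"

lemma length_sorted_list_of_multiset: "length (sorted_list_of_multiset D) = size D"
  by (metis mset_sorted_list_of_multiset size_mset)

lemma size_slice: "b \<le> size D \<Longrightarrow> size (slice a b D) = b - a"
  by (simp add: slice_def length_sorted_list_of_multiset)

lemma slice_subset: "slice a b D \<subseteq># D"
proof -
  let ?xs = "sorted_list_of_multiset D"
  have "mset (drop a (take b ?xs)) \<subseteq># mset (take b ?xs)"
    by (metis append_take_drop_id mset_append mset_subset_eq_add_right)
  also have "\<dots> \<subseteq># mset ?xs"
    by (metis append_take_drop_id mset_append mset_subset_eq_add_left)
  finally show ?thesis
    by (simp add: slice_def)
qed

text \<open>In a sorted list the elements up to \<open>v\<close> form a prefix, and two prefixes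
  meet in the shorter one.\<close>

lemma length_filter_take_sorted:
  "sorted xs \<Longrightarrow> length (filter (\<lambda>x. x \<le> v) (take k xs)) = min k (length (filter (\<lambda>x. x \<le> v) xs))"
proof (induction xs arbitrary: k)
  case (Cons x xs)
  show ?case
  proof (cases k)
    case (Suc j)
    have "filter (\<lambda>x. x \<le> v) (x # xs) = []" if "\<not> x \<le> v"
      using that Cons.prems by (fastforce simp: filter_empty_conv)
    moreover have "filter (\<lambda>x. x \<le> v) (take k (x # xs)) = []" if "\<not> x \<le> v"
      using that Cons.prems set_take_subset[of k "x # xs"] by (fastforce simp: filter_empty_conv)
    ultimately show ?thesis
      using Cons Suc by (cases "x \<le> v") auto
  qed simp
qed simp

text \<open>The prefix property is applied to the first \<open>b\<close> elements and, among these,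
  to the first \<open>a\<close>. Dominance between slices thus reduces to arithmetic in the counts
  of the original datasets.\<close>

lemma size_filter_slice:
  "size {#x \<in># slice a b D. x \<le> v#} = min b (size {#x \<in># D. x \<le> v#}) - a"
proof -
  let ?P = "\<lambda>x. x \<le> v" and ?xs = "sorted_list_of_multiset D"
  let ?ys = "take b ?xs"
  have len: "size (filter_mset ?P (mset zs)) = length (filter ?P zs)" for zs
    by (metis mset_filter size_mset)
  have "length (filter ?P ?ys) = length (filter ?P (take a ?ys)) + length (filter ?P (drop a ?ys))"
    by (metis append_take_drop_id filter_append length_append)
  moreover have "length (filter ?P (take a ?ys)) = min a (length (filter ?P ?ys))"
    by (intro length_filter_take_sorted sorted_wrt_take sorted_sorted_list_of_multiset)
  moreover have "length (filter ?P ?ys) = min b (length (filter ?P ?xs))"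
    by (intro length_filter_take_sorted sorted_sorted_list_of_multiset)
  moreover have "length (filter ?P ?xs) = size (filter_mset ?P D)"
    by (metis len mset_sorted_list_of_multiset)
  ultimately show ?thesis
    unfolding slice_def len by linarith
qed

section \<open>Stochastic dominance under trimming\<close>

lemma datasets_subset: "D \<in> datasets R \<Longrightarrow> D' \<subseteq># D \<Longrightarrow> D' \<in> datasets R"
  by (auto simp: datasets_def dest: mset_subset_eqD)

text \<open>With \<open>n = size D\<close> and \<open>F\<close> points up to \<open>v\<close>, this
  is \<open>(F - k) / (n - k) \<le> F / n\<close> with truncated \<open>F - k\<close>, a consequence
  of \<open>F \<le> n\<close>.\<close>

lemma stoch_dominates_drop_least:
  assumes "k < size D"
  shows "stoch_dominates (slice k (size D) D) D"
  unfolding stoch_dominates_def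
proof (intro conjI allI)
  have sz: "size (slice k (size D) D) = size D - k"
    by (simp add: size_slice)
  then show "slice k (size D) D \<noteq> {#}"
    using assms by auto
  show "D \<noteq> {#}" using assms by auto
  fix v :: real
  define F where "F = size {#x \<in># D. x \<le> v#}"
  have F: "F \<le> size D" by (simp add: F_def size_mset_mono)
  have "real (F - k) * real (size D) \<le> real F * real (size D - k)"
  proof (cases "F \<le> k")
    case False
    have "real k * real F \<le> real k * real (size D)" using F by (intro mult_left_mono) auto
    with False assms F show ?thesis by (simp add: of_nat_diff algebra_simps)
  qed simp
  then show "real (size {#x \<in># slice k (size D) D. x \<le> v#}) / real (size (slice k (size D) D))
      \<le> real (size {#x \<in># D. x \<le> v#}) / real (size D)"
    using assms F unfolding size_filter_slice sz F_def[symmetric]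
    by (simp add: divide_simps min_absorb2 mult.commute split: if_splits)
qed

lemma stoch_dominates_drop_greatest:
  assumes "k < size D"
  shows "stoch_dominates D (slice 0 (size D - k) D)"
  unfolding stoch_dominates_def
proof (intro conjI allI)
  have sz: "size (slice 0 (size D - k) D) = size D - k"
    by (simp add: size_slice)
  then show "slice 0 (size D - k) D \<noteq> {#}"
    using assms by auto
  show "D \<noteq> {#}" using assms by auto
  fix v :: real
  define F where "F = size {#x \<in># D. x \<le> v#}"
  have F: "F \<le> size D" by (simp add: F_def size_mset_mono)
  have "real F * real (size D - k) \<le> real (min (size D - k) F) * real (size D)"
  proof (cases "F \<le> size D - k")
    case True
    then show ?thesis by (simp add: mult_left_mono)
  next
    case False
    moreover have "real F * real (size D - k) \<le> real (size D) * real (size D - k)"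
      using F by (intro mult_right_mono) auto
    ultimately show ?thesis by (simp add: mult.commute)
  qed
  then show "real (size {#x \<in># D. x \<le> v#}) / real (size D)
    \<le> real (size {#x \<in># slice 0 (size D - k) D. x \<le> v#}) / real (size (slice 0 (size D - k) D))"
    using assms F unfolding size_filter_slice sz F_def[symmetric]
    by (simp add: divide_simps mult.commute split: if_splits)
qed

text \<open>Trimming \<open>W\<close> points at both ends absorbs an edit of at most \<open>W\<close> points: after it, the
  trimmed dataset stays between the two extreme ways of deleting \<open>2 W\<close> points of the original one.\<close>

lemma stoch_dominates_trim_near:
  assumes "mset_dist D D' \<le> W" "2 * W < size D" "2 * W < size D'"
  shows "stoch_dominates (slice (2 * W) (size D) D) (slice W (size D' - W) D')" (is ?upper)
    and "stoch_dominates (slice W (size D' - W) D') (slice 0 (size D - 2 * W) D)" (is ?lower)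
proof -
  \<comment> \<open>\<open>D'\<close> arises from \<open>D\<close> by \<open>p\<close> deletions and
    \<open>q\<close> insertions, with \<open>p + q \<le> W\<close>. The extreme slices have
    \<open>s = n - 2 * W\<close> points, the middle one \<open>s - p + q\<close>.\<close>
  define n n' p q where "n = size D" and "n' = size D'"
    and "p = size (D - D')" and "q = size (D' - D)"
  have sz: "size (slice (2 * W) (size D) D) = n - 2 * W"
    "size (slice W (size D' - W) D') = n' - 2 * W"
    "size (slice 0 (size D - 2 * W) D) = n - 2 * W"
    by (simp_all add: size_slice n_def n'_def)
  have ne: "slice (2 * W) (size D) D \<noteq> {#}" "slice W (size D' - W) D' \<noteq> {#}"
    "slice 0 (size D - 2 * W) D \<noteq> {#}"
    using sz assms(2,3) by (auto simp: n_def n'_def)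
  have pq: "p + q \<le> W" "n + q = n' + p" "2 * W < n" "2 * W < n'"
    using assms size_add_diff_swap[of D D']
    by (auto simp: mset_dist_def n_def n'_def p_def q_def)
  define s where "s = real n - 2 * real W"
  have s: "s > 0" "real (n - 2 * W) = s" "real (n' - 2 * W) = s - real p + real q"
    "s - real p + real q > 0"
    using pq by (auto simp: s_def of_nat_diff)
  have "real (size {#x \<in># slice (2 * W) (size D) D. x \<le> v#}) / real (n - 2 * W)
      \<le> real (size {#x \<in># slice W (size D' - W) D'. x \<le> v#}) / real (n' - 2 * W)
    \<and> real (size {#x \<in># slice W (size D' - W) D'. x \<le> v#}) / real (n' - 2 * W)
      \<le> real (size {#x \<in># slice 0 (size D - 2 * W) D. x \<le> v#}) / real (n - 2 * W)" for v
  proof -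
    define F F' where "F = size {#x \<in># D. x \<le> v#}" and "F' = size {#x \<in># D'. x \<le> v#}"
    have F: "F \<le> n" "F' \<le> n'" "F \<le> F' + p" "F' \<le> F + q"
      using size_filter_mset_le_diff[of "\<lambda>x. x \<le> v" D D']
        size_filter_mset_le_diff[of "\<lambda>x. x \<le> v" D' D]
      by (simp_all add: F_def F'_def n_def n'_def p_def q_def size_mset_mono)
    have up: "real (F - 2 * W) * real (n' - 2 * W)
        \<le> real (min (n' - W) F' - W) * real (n - 2 * W)"
    \<comment> \<open>Either the left fraction is 0, or the right one is 1, or no truncation occurs
      and \<open>x = F - 2 * W\<close> lies between 0 and \<open>s\<close>.\<close>
    proof (cases "F \<le> 2 * W \<or> n' - W \<le> F'")
      case True
      then consider "F \<le> 2 * W" | "n' - W \<le> F'" by blast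
      then show ?thesis
      proof cases
        case 2
        then have "min (n' - W) F' - W = n' - 2 * W" by simp
        moreover have "real (F - 2 * W) * real (n' - 2 * W) \<le> real (n - 2 * W) * real (n' - 2 * W)"
          using F by (intro mult_right_mono) auto
        ultimately show ?thesis by (simp only: mult.commute)
      qed simp
    next
      case False
      define x where "x = real F - 2 * real W"
      have x: "0 \<le> x" "x \<le> s" "real (F - 2 * W) = x"
        using False F by (auto simp: x_def s_def of_nat_diff)
      \<comment> \<open>The trimming margin absorbs the edit: first \<open>q \<le> W\<close>, then
        \<open>x \<le> s\<close>.\<close>
      have "x * (real q - real p) \<le> x * real (W - p)"
        using x pq by (intro mult_left_mono) auto
      also have "\<dots> \<le> s * real (W - p)"
        using x by (intro mult_right_mono) auto
      finally have "x * (s - real p + real q) \<le> (x + real W - real p) * s"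
        using pq by (simp add: algebra_simps of_nat_diff)
      also have "\<dots> \<le> real (F' - W) * s"
        using F(3) s(1) unfolding x_def by (intro mult_right_mono) linarith+
      also have "F' - W = min (n' - W) F' - W"
        using False by simp
      finally show ?thesis using s x by simp
    qed
    have lo: "real (min (n' - W) F' - W) * real (n - 2 * W)
        \<le> real (min (n - 2 * W) F) * real (n' - 2 * W)"
    proof (cases "n - 2 * W \<le> F \<or> F' \<le> W")
      case True
      then consider "n - 2 * W \<le> F" | "F' \<le> W" by blast
      then show ?thesis
      proof cases
        case 1
        then have "min (n - 2 * W) F = n - 2 * W" by simp
        moreover have "real (min (n' - W) F' - W) * real (n - 2 * W)
            \<le> real (n' - 2 * W) * real (n - 2 * W)"
          by (intro mult_right_mono) auto
        ultimately show ?thesis by (simp only: mult.commute)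
      qed simp
    next
      case False
      have Fs: "real F \<le> s" using False pq unfolding s_def by linarith
      \<comment> \<open>For the lower comparison the margin pays for the deletions through
        \<open>p \<le> W - q\<close> and \<open>F \<le> s\<close>.\<close>
      have "(real F + real q - real W) * s = real F * s - (real W - real q) * s"
        by (simp add: algebra_simps)
      also have "\<dots> \<le> real F * s - real p * s"
        using pq s by (intro diff_left_mono mult_right_mono) auto
      also have "\<dots> \<le> real F * s - real p * real F"
        using Fs by (intro diff_left_mono mult_left_mono) auto
      also have "\<dots> \<le> real F * (s - real p + real q)"
        by (simp add: algebra_simps)
      finally have *: "(real F + real q - real W) * s \<le> real F * (s - real p + real q)" .
      have "real (min (n' - W) F' - W) * s \<le> (real F + real q - real W) * s"
        using False F(4) s(1) by (intro mult_right_mono) linarith+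
      also note *
      finally show ?thesis using s False by simp
    qed
    have cross: "a / b \<le> c / d" if "a * d \<le> c * b" "b > 0" "d > 0" for a b c d :: real
      using that by (simp add: divide_simps mult.commute)
    have "min (size D) F - 2 * W = F - 2 * W"
      using F by (simp add: n_def)
    then show ?thesis
      using up lo pq
      unfolding size_filter_slice F_def[symmetric] F'_def[symmetric] n_def[symmetric]
        n'_def[symmetric] diff_zero
      by (intro conjI cross) simp_all
  qed
  then show ?upper ?lower
    unfolding stoch_dominates_def sz using ne by auto
qed

section \<open>The inverse sensitivity mechanism\<close>

text \<open>As a distance to a set, the score is 1-Lipschitz whatever the statistic \<open>g\<close> is.\<close>

definition edit_score :: "real \<Rightarrow> (real multiset \<Rightarrow> real) \<Rightarrow> real multiset \<Rightarrow> real \<Rightarrow> nat" where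
  "edit_score R g D t = (LEAST k. \<exists>D'\<in>datasets R. g D' = t \<and> mset_dist D D' = k)"

lemma edit_score_witness:
  assumes "t \<in> g ` datasets R"
  obtains D' where "D' \<in> datasets R" "g D' = t" "mset_dist D D' = edit_score R g D t"
proof -
  have "\<exists>D'\<in>datasets R. g D' = t \<and> mset_dist D D' = edit_score R g D t"
    unfolding edit_score_def by (rule LeastI_ex) (use assms in auto)
  then show ?thesis using that by blast
qed

lemma edit_score_le: "D' \<in> datasets R \<Longrightarrow> edit_score R g D (g D') \<le> mset_dist D D'"
  unfolding edit_score_def by (rule Least_le) auto

lemma edit_score_self: "D \<in> datasets R \<Longrightarrow> edit_score R g D (g D) = 0"
  using edit_score_le[of D R g D] by (simp add: mset_dist_def)

lemma edit_score_lipschitz: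
  assumes "t \<in> g ` datasets R"
  shows "edit_score R g D t \<le> edit_score R g D' t + mset_dist D D'"
proof -
  obtain E where E: "E \<in> datasets R" "g E = t" "mset_dist D' E = edit_score R g D' t"
    using edit_score_witness[OF assms] .
  then show ?thesis
    using edit_score_le[OF E(1), of g D] mset_dist_triangle[of D E D'] by simp
qed

text \<open>The weight of a value and the normaliser \<open>Z\<close> each change by at most a
  factor \<open>exp \<eta>\<close> between neighbours, hence the privacy parameter
  \<open>2 * \<eta>\<close>. Since \<open>Z D \<ge> 1\<close>, a value of score above
  \<open>W\<close> has probability at most \<open>exp (- \<eta> * (real W + 1))\<close>; a union
  bound over the finite range gives the error term. The integrand \<open>f\<close> is arbitrary
  because the loss to be bounded depends on \<open>D\<close>.\<close>

lemma inverse_sensitivity_mechanism: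
  fixes g :: "real multiset \<Rightarrow> real"
  assumes fin: "finite (g ` datasets R)" and eta: "\<eta> \<ge> 0"
  obtains A where "A \<in> dp_algorithms R (2 * \<eta>)"
    and "\<And>D W f a b. D \<in> datasets R \<Longrightarrow>
      (\<And>D'. D' \<in> datasets R \<Longrightarrow> mset_dist D D' \<le> W \<Longrightarrow> f (g D') \<le> a) \<Longrightarrow>
      (\<And>D'. D' \<in> datasets R \<Longrightarrow> f (g D') \<le> ennreal b) \<Longrightarrow>
      b \<ge> 0 \<Longrightarrow> f \<in> borel_measurable borel \<Longrightarrow>
      (\<integral>\<^sup>+ y. f y \<partial>A D)
        \<le> a + ennreal (real (card (g ` datasets R)) * exp (- \<eta> * (real W + 1)) * b)"
proof -
  define G where "G = g ` datasets R"
  define w where "w D t = exp (- \<eta> * real (edit_score R g D t))" for D t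
  define Z where "Z D = (\<Sum>t\<in>G. w D t)" for D
  define q where "q D t = (if t \<in> G then w D t / Z D else 0)" for D t
  define P where "P D = embed_pmf (q D)" for D
  have finG: "finite G" using fin by (simp add: G_def)
  have "{#} \<in> datasets R" by (simp add: datasets_def)
  then have neG: "G \<noteq> {}" by (auto simp: G_def)
  have w_pos: "w D t > 0" for D t by (simp add: w_def)
  have Z_pos: "Z D > 0" for D
    unfolding Z_def using finG neG w_pos by (intro sum_pos) auto
  have q_nn: "q D t \<ge> 0" for D t
    using w_pos[of D t] Z_pos[of D] by (simp add: q_def)
  have sum_q: "(\<Sum>t\<in>G. q D t) = 1" for D
    using Z_pos[of D] by (simp add: q_def Z_def flip: sum_divide_distrib)
  moreover have "(\<integral>\<^sup>+ t. ennreal (q D t) \<partial>count_space UNIV) = ennreal (\<Sum>t\<in>G. q D t)" for D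
  proof -
    have "(\<integral>\<^sup>+ t. ennreal (q D t) \<partial>count_space UNIV) = (\<Sum>t\<in>G. ennreal (q D t))"
      by (intro nn_integral_count_space' finG) (auto simp: q_def)
    then show ?thesis using q_nn by (simp add: sum_ennreal)
  qed
  ultimately have pmf_P: "pmf (P D) t = q D t" for D t
    unfolding P_def using q_nn by (intro pmf_embed_pmf) auto
  have set_P: "set_pmf (P D) \<subseteq> G" for D
    by (auto simp: set_pmf_eq pmf_P q_def)
  \<comment> \<open>The push-forward along the identity replaces the discrete sigma-algebra of the
    pmf by the Borel sets.\<close>
  define A where "A D = distr (measure_pmf (P D)) borel (\<lambda>t. t)" for D
  have w_le: "w D t \<le> exp \<eta> * w D' t" if "t \<in> G" "neighboring D D'"
    for D D' :: "real multiset" and t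
  proof -
    have "edit_score R g D' t \<le> edit_score R g D t + 1"
      using edit_score_lipschitz[of t g R D' D] that mset_dist_commute[of D' D]
      by (simp add: G_def neighboring_def)
    then have "real (edit_score R g D' t) \<le> real (edit_score R g D t) + 1" by linarith
    from mult_left_mono[OF this eta]
    have "- \<eta> * real (edit_score R g D t) \<le> \<eta> + - \<eta> * real (edit_score R g D' t)"
      by (simp add: algebra_simps)
    then show ?thesis
      unfolding w_def exp_add[symmetric] by simp
  qed
  have neighboring_sym: "neighboring D' D" if "neighboring D D'" for D D' :: "real multiset"
    using that mset_dist_commute[of D D'] by (simp add: neighboring_def)
  have q_le: "q D t \<le> exp (2 * \<eta>) * q D' t" if "neighboring D D'"
    for D D' :: "real multiset" and t
  proof (cases "t \<in> G")
    case True
    have "Z D' \<le> exp \<eta> * Z D"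
      unfolding Z_def sum_distrib_left
      by (intro sum_mono w_le neighboring_sym[OF that])
    then have "w D t * Z D' \<le> (exp \<eta> * w D' t) * (exp \<eta> * Z D)"
      using w_le[OF True that] w_pos[of D' t] Z_pos[of D'] by (intro mult_mono) auto
    also have "\<dots> = (exp (2 * \<eta>) * w D' t) * Z D"
      unfolding mult_2 exp_add by (simp add: mult_ac)
    finally show ?thesis
      using True Z_pos[of D] Z_pos[of D'] by (simp add: q_def pos_divide_le_eq pos_le_divide_eq)
  qed (simp add: q_def)
  have measure_A: "measure (A D) S = (\<Sum>t\<in>S \<inter> G. q D t)" if "S \<in> sets borel"
    for D :: "real multiset" and S :: "real set"
  proof -
    have "measure (A D) S = measure (P D) S"
      unfolding A_def using that by (subst measure_distr) auto
    also have "\<dots> = measure (P D) (S \<inter> G)"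
      using set_P[of D] by (intro measure_prob_cong_0) (auto simp: pmf_P q_def)
    also have "\<dots> = (\<Sum>t\<in>S \<inter> G. q D t)"
      using finG by (simp add: measure_measure_pmf_finite pmf_P)
    finally show ?thesis .
  qed
  have dp: "A \<in> dp_algorithms R (2 * \<eta>)"
    unfolding dp_algorithms_def
  proof (intro CollectI conjI ballI impI)
    fix D D' :: "real multiset" and S :: "real set" assume "neighboring D D'" "S \<in> sets borel"
    then show "measure (A D) S \<le> exp (2 * \<eta>) * measure (A D') S"
      by (simp add: measure_A sum_distrib_left sum_mono q_le)
  next
    fix D :: "real multiset" show "prob_space (A D)" "sets (A D) = sets borel"
      unfolding A_def by (auto intro!: measure_pmf.prob_space_distr)
  qed
  have loss: "(\<integral>\<^sup>+ y. f y \<partial>A D)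
        \<le> a + ennreal (real (card G) * exp (- \<eta> * (real W + 1)) * b)"
    if D: "D \<in> datasets R"
      and near: "\<And>D'. D' \<in> datasets R \<Longrightarrow> mset_dist D D' \<le> W \<Longrightarrow> f (g D') \<le> a"
      and far: "\<And>D'. D' \<in> datasets R \<Longrightarrow> f (g D') \<le> ennreal b"
      and b: "b \<ge> 0" and meas: "f \<in> borel_measurable borel"
    for D W f a b
  proof -
    define e where "e = exp (- \<eta> * (real W + 1))"
    \<comment> \<open>The value \<open>g D\<close> has score 0 and so contributes 1 to
      \<open>Z D\<close>.\<close>
    have "g D \<in> G" using D by (simp add: G_def)
    then have Z_ge: "Z D \<ge> 1"
      unfolding Z_def using member_le_sum[of "g D" G "w D"] finG w_pos
      by (simp add: w_def edit_score_self[OF D] less_imp_le)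
    have term_le: "f t * ennreal (q D t) \<le> a * ennreal (q D t) + ennreal (e * b)"
      if t: "t \<in> G" for t
    proof -
      obtain E where E: "E \<in> datasets R" "g E = t" "mset_dist D E = edit_score R g D t"
        using edit_score_witness[OF t[unfolded G_def]] .
      show ?thesis
      proof (cases "mset_dist D E \<le> W")
        case True
        then have "f t * ennreal (q D t) \<le> a * ennreal (q D t)"
          using near E by (intro mult_right_mono) auto
        then show ?thesis by (simp add: add_increasing2)
      next
        case False
        have "q D t \<le> w D t"
          using t Z_ge w_pos[of D t] Z_pos[of D] by (simp add: q_def divide_simps)
        \<comment> \<open>Scores are integers, so a score above \<open>W\<close> is at least
          \<open>W + 1\<close>.\<close>
        also have "\<dots> \<le> e"
          using False E(3) eta by (auto simp: w_def e_def intro!: mult_left_mono)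
        finally have "f t * ennreal (q D t) \<le> ennreal b * ennreal e"
          using far[OF E(1)] E(2) by (intro mult_mono) (auto simp: ennreal_leI)
        also have "\<dots> = ennreal (e * b)"
          using b by (simp add: e_def mult.commute flip: ennreal_mult)
        finally show ?thesis by (simp add: add_increasing)
      qed
    qed
    have "(\<integral>\<^sup>+ y. f y \<partial>A D) = (\<integral>\<^sup>+ t. f t \<partial>measure_pmf (P D))"
      unfolding A_def using meas by (subst nn_integral_distr) auto
    also have "\<dots> = (\<Sum>t\<in>G. f t * ennreal (q D t))"
      using finG set_P[of D]
      by (subst nn_integral_measure_pmf_support[of G]) (auto simp: pmf_P q_def)
    also have "\<dots> \<le> (\<Sum>t\<in>G. a * ennreal (q D t) + ennreal (e * b))"
      by (intro sum_mono term_le)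
    also have "\<dots> = a * ennreal (\<Sum>t\<in>G. q D t) + ennreal (real (card G) * e * b)"
    proof -
      have "(\<Sum>t\<in>G. ennreal (e * b)) = ennreal (real (card G) * e * b)"
        using b by (simp add: e_def ennreal_of_nat_eq_real_of_nat mult.assoc flip: ennreal_mult)
      then show ?thesis
        by (simp only: sum.distrib sum_distrib_left[symmetric] sum_ennreal q_nn)
    qed
    also have "\<dots> = a + ennreal (real (card G) * e * b)"
      by (simp add: sum_q)
    finally show ?thesis by (simp add: e_def)
  qed
  show ?thesis
    by (rule that[OF dp loss[unfolded G_def]])
qed

section \<open>Lower bound on the subset risk\<close>

lemma dp_group_privacy:
  assumes A: "A \<in> dp_algorithms R \<epsilon>" and S: "S \<in> sets borel"
  shows "D + E \<in> datasets R \<Longrightarrow> measure (A D) S \<le> exp (\<epsilon> * real (size E)) * measure (A (D + E)) S"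
proof (induction E)
  case (add x E)
  have sub: "D + E \<in> datasets R" using add.prems by (auto simp: datasets_def)
  have nb: "neighboring (D + E) (D + add_mset x E)"
    by (simp add: neighboring_def mset_dist_def)
  have "measure (A D) S \<le> exp (\<epsilon> * real (size E)) * measure (A (D + E)) S"
    by (rule add.IH[OF sub])
  also have "\<dots> \<le> exp (\<epsilon> * real (size E)) * (exp \<epsilon> * measure (A (D + add_mset x E)) S)"
    using A S sub add.prems nb by (intro mult_left_mono) (auto simp: dp_algorithms_def)
  finally show ?case
    by (simp add: algebra_simps exp_add)
qed simp

text \<open>For any private \<open>A\<close>, the triangle inequality through the output of
  \<open>A D'\<close> bounds the loss by the expected losses to \<open>\<theta> D'\<close> and to
  \<open>\<theta> D\<close>. Group privacy turns the second into an expectation under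
  \<open>A D\<close> at the cost of a factor \<open>e\<close>. Both datasets compete in the
  supremum, so the total is at most \<open>1 + e \<le> 2 * e\<close> times it.\<close>

lemma loss_le_subset_risk:
  assumes D: "D \<in> datasets R" and sub: "D' \<subseteq># D" "real (size D') \<ge> real (size D) - 1 / \<epsilon>"
    and eps: "\<epsilon> > 0"
    and nn: "\<And>a b. loss a b \<ge> 0" and sym: "\<And>a b. loss a b = loss b a"
    and tri: "\<And>a b d. loss a d \<le> loss a b + loss b d"
    and meas: "\<And>a. (\<lambda>y. loss y a) \<in> borel_measurable borel"
  shows "ennreal (loss (\<theta> D') (\<theta> D)) \<le> ennreal (2 * exp 1) * subset_risk R loss \<theta> D \<epsilon>"
proof -
  define Ds where "Ds = {D'. D' \<subseteq># D \<and> real (size D') \<ge> real (size D) - 1 / \<epsilon>}"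
  have D': "D' \<in> datasets R" using datasets_subset D sub by blast
  have bound: "ennreal (loss (\<theta> D') (\<theta> D)) \<le>
      ennreal (2 * exp 1) * (SUP D'\<in>Ds. expected_loss loss \<theta> A D')"
    if A: "A \<in> dp_algorithms R \<epsilon>" for A
  proof -
    let ?M = "A D'" and ?N = "A D" and ?s = "SUP D'\<in>Ds. expected_loss loss \<theta> A D'"
    interpret M: prob_space ?M using A D' by (auto simp: dp_algorithms_def)
    interpret N: prob_space ?N using A D by (auto simp: dp_algorithms_def)
    have sets: "sets ?M = sets borel" "sets ?N = sets borel"
      using A D D' by (auto simp: dp_algorithms_def)
    note [measurable] = meas
    note [measurable_cong] = sets
    have "\<epsilon> * real (size (D - D')) \<le> 1"
    proof -
      have "real (size (D - D')) \<le> 1 / \<epsilon>"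
        using sub by (simp add: size_Diff_submset size_mset_mono of_nat_diff)
      then show ?thesis using eps by (simp add: field_simps)
    qed
    then have priv: "measure ?M S \<le> exp 1 * measure ?N S" if "S \<in> sets borel" for S
    proof -
      have "measure ?M S \<le> exp (\<epsilon> * real (size (D - D'))) * measure ?N S"
        using dp_group_privacy[OF A that, of D' "D - D'"] D sub by simp
      also have "\<dots> \<le> exp 1 * measure ?N S"
        using \<open>\<epsilon> * real (size (D - D')) \<le> 1\<close> by (intro mult_right_mono) auto
      finally show ?thesis .
    qed
    have le_meas: "?M \<le> scale_measure (ennreal (exp 1)) ?N"
      using priv sets
      by (subst le_measure) (auto simp: le_fun_def M.emeasure_eq_measure N.emeasure_eq_measure
          ennreal_leI simp flip: ennreal_mult)
    have "ennreal (loss (\<theta> D') (\<theta> D)) = (\<integral>\<^sup>+ y. ennreal (loss (\<theta> D') (\<theta> D)) \<partial>?M)"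
      by (simp add: M.emeasure_space_1)
    also have "\<dots> \<le> (\<integral>\<^sup>+ y. ennreal (loss y (\<theta> D')) + ennreal (loss y (\<theta> D)) \<partial>?M)"
      using tri[of "\<theta> D'" "\<theta> D"] sym[of "\<theta> D'"] nn
      by (intro nn_integral_mono) (simp flip: ennreal_plus)
    also have "\<dots> = expected_loss loss \<theta> A D' + (\<integral>\<^sup>+ y. ennreal (loss y (\<theta> D)) \<partial>?M)"
      unfolding expected_loss_def by (intro nn_integral_add) auto
    also have "(\<integral>\<^sup>+ y. ennreal (loss y (\<theta> D)) \<partial>?M) \<le>
        (\<integral>\<^sup>+ y. ennreal (loss y (\<theta> D)) \<partial>scale_measure (ennreal (exp 1)) ?N)"
      using le_meas sets by (intro nn_integral_mono_measure) auto
    also have "\<dots> = ennreal (exp 1) * expected_loss loss \<theta> A D"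
      unfolding expected_loss_def by (intro nn_integral_scale_measure) auto
    also have "expected_loss loss \<theta> A D' + ennreal (exp 1) * expected_loss loss \<theta> A D
        \<le> ennreal (exp 1) * ?s + ennreal (exp 1) * ?s"
    proof (intro add_mono mult_left_mono)
      have "expected_loss loss \<theta> A D' \<le> ?s"
        using sub by (intro SUP_upper) (auto simp: Ds_def)
      also have "\<dots> = ennreal 1 * ?s" by simp
      also have "\<dots> \<le> ennreal (exp 1) * ?s"
        by (intro mult_right_mono ennreal_leI) auto
      finally show "expected_loss loss \<theta> A D' \<le> ennreal (exp 1) * ?s" .
      show "expected_loss loss \<theta> A D \<le> ?s"
        using eps by (intro SUP_upper) (auto simp: Ds_def)
    qed auto
    also have "\<dots> = ennreal (2 * exp 1) * ?s"
      by (simp add: distrib_right[symmetric] flip: ennreal_plus)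
    finally show ?thesis by (simp add: add_mono)
  qed
  show ?thesis
  proof -
    let ?x = "ennreal (loss (\<theta> D') (\<theta> D))" and ?k = "2 * exp 1 :: real"
    \<comment> \<open>The constant is divided out before the infimum over \<open>A\<close> is taken,
      so that each bound has the bare supremum on its right.\<close>
    have inv: "ennreal (inverse ?k) * (ennreal ?k * z) = z" for z
      by (simp flip: mult.assoc ennreal_mult)
    have "ennreal (inverse ?k) * ?x \<le> subset_risk R loss \<theta> D \<epsilon>"
      unfolding subset_risk_def Ds_def[symmetric]
    proof (rule INF_greatest)
      fix A assume "A \<in> dp_algorithms R \<epsilon>"
      from mult_left_mono[OF bound[OF this], of "ennreal (inverse ?k)"]
      show "ennreal (inverse ?k) * ?x \<le> (SUP D'\<in>Ds. expected_loss loss \<theta> A D')"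
        by (simp only: inv zero_le)
    qed
    from mult_left_mono[OF this, of "ennreal ?k"] inv[of ?x] show ?thesis
      by (simp add: mult.left_commute)
  qed
qed

section \<open>Competing with the subset risk\<close>

lemma abs_diff_floor_multiple:
  fixes x \<beta> :: real
  assumes "\<beta> > 0"
  shows "\<bar>\<beta> * of_int \<lfloor>x / \<beta>\<rfloor> - x\<bar> \<le> \<beta>"
proof -
  have "\<beta> * of_int \<lfloor>x / \<beta>\<rfloor> \<le> \<beta> * (x / \<beta>)" "\<beta> * (x / \<beta>) \<le> \<beta> * (of_int \<lfloor>x / \<beta>\<rfloor> + 1)"
    using assms by (intro mult_left_mono; linarith)+
  then show ?thesis using assms by (simp add: algebra_simps)
qed

text \<open>The multipliers run between two floors: rounding \<open>- R / \<beta>\<close> down costs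
  at most 1, and counting both endpoints 1 more.\<close>

lemma floor_multiples_of_interval:
  fixes R \<beta> :: real
  assumes "\<beta> > 0" "R \<ge> 0"
  defines "G \<equiv> (\<lambda>x. \<beta> * of_int \<lfloor>x / \<beta>\<rfloor>) ` {-R..R}"
  shows "finite G" "real (card G) \<le> 2 * R / \<beta> + 2"
proof -
  let ?I = "{\<lfloor>- R / \<beta>\<rfloor>..\<lfloor>R / \<beta>\<rfloor>}"
  have sub: "G \<subseteq> (\<lambda>k. \<beta> * of_int k) ` ?I"
    using assms divide_right_mono[of "- R" _ \<beta>] divide_right_mono[of _ R \<beta>]
    by (force simp: G_def intro!: imageI floor_mono)
  then show "finite G" by (rule finite_subset) simp
  have "card G \<le> card ((\<lambda>k. \<beta> * of_int k) ` ?I)"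
    using sub by (intro card_mono) auto
  also have "\<dots> \<le> card ?I" by (rule card_image_le) simp
  finally have "real (card G) \<le> real (card ?I)" by simp
  also have "\<dots> = of_int (\<lfloor>R / \<beta>\<rfloor> - \<lfloor>- R / \<beta>\<rfloor> + 1)"
  proof -
    have "\<lfloor>- R / \<beta>\<rfloor> \<le> \<lfloor>R / \<beta>\<rfloor>"
      using assms by (intro floor_mono divide_right_mono) auto
    then show ?thesis by simp
  qed
  also have "\<dots> \<le> 2 * R / \<beta> + 2"
    by (simp add: minus_divide_left[symmetric]) linarith
  finally show "real (card G) \<le> 2 * R / \<beta> + 2" .
qed

section \<open>Loss of the trimmed property\<close>

lemma monotone_property_between:
  assumes "monotone_property R \<theta>" "D1 \<in> datasets R" "D2 \<in> datasets R" "E \<in> datasets R"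
    and "stoch_dominates D2 E" "stoch_dominates E D1"
  shows "\<theta> E \<in> {min (\<theta> D1) (\<theta> D2)..max (\<theta> D1) (\<theta> D2)}"
  using assms unfolding monotone_property_def atLeastAtMost_iff
  by (meson max.coboundedI1 max.coboundedI2 min.coboundedI1 min.coboundedI2)

text \<open>The monotonicity assumption on the loss is one-sided: it controls the loss from a point down to
  points below it, so a factor 2 is lost when \<open>y\<close> lies above \<open>x\<close>.\<close>

lemma loss_between:
  fixes loss :: "real \<Rightarrow> real \<Rightarrow> real"
  assumes nn: "\<And>a b. loss a b \<ge> 0" and sym: "\<And>a b. loss a b = loss b a"
    and tri: "\<And>a b d. loss a d \<le> loss a b + loss b d"
    and mono: "\<And>t t1 t2. t \<ge> t1 \<Longrightarrow> t1 \<ge> t2 \<Longrightarrow> loss t t1 \<le> loss t t2"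
    and "x \<in> {a..b}" "y \<in> {a..b}"
  shows "loss y x \<le> 2 * max (loss a x) (loss b x)"
proof (cases "y \<le> x")
  case True
  then show ?thesis
    using mono[of y x a] assms(5,6) sym[of x] nn[of a x] by auto
next
  case False
  \<comment> \<open>Here \<open>loss y x \<le> loss y b + loss b x\<close>, and
    \<open>loss b y \<le> loss b x\<close> because \<open>y\<close> lies between \<open>x\<close>
    and \<open>b\<close>.\<close>
  then show ?thesis
    using mono[of y b x] tri[of y x b] sym[of b y] assms(5,6) by auto
qed

text \<open>The threshold \<open>3 * W\<close> leaves room for \<open>W\<close> edits: above it,
  every dataset that near keeps more than \<open>2 * W\<close> points; up to it, every such dataset
  has at most \<open>4 * W\<close> points, so few that all of them may be deleted.\<close>

definition trimmed_property :: "nat \<Rightarrow> (real multiset \<Rightarrow> real) \<Rightarrow> real multiset \<Rightarrow> real" where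
  "trimmed_property W \<theta> D =
    (if size D \<le> 3 * W then \<theta> {#} else \<theta> (slice W (size D - W) D))"

text \<open>\<open>E\<close> is empty if \<open>D'\<close> is small, and otherwise \<open>D\<close>
  without its \<open>2 * W\<close> greatest or \<open>2 * W\<close> least points; the values of
  \<open>\<theta>\<close> at these two enclose both the trimmed value and \<open>\<theta> D\<close>.
  The number \<open>k\<close> stands for \<open>1 / \<epsilon>\<close>.\<close>

lemma trimmed_property_near_loss:
  fixes loss :: "real \<Rightarrow> real \<Rightarrow> real"
  assumes mono: "monotone_property R \<theta>"
    and nn: "\<And>a b. loss a b \<ge> 0" and sym: "\<And>a b. loss a b = loss b a"
    and tri: "\<And>a b d. loss a d \<le> loss a b + loss b d"
    and below: "\<And>t t1 t2. t \<ge> t1 \<Longrightarrow> t1 \<ge> t2 \<Longrightarrow> loss t t1 \<le> loss t t2"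
    and D: "D \<in> datasets R" and D': "D' \<in> datasets R" and near: "mset_dist D D' \<le> W"
    and k: "4 * real W \<le> k"
  obtains E where "E \<subseteq># D" "real (size E) \<ge> real (size D) - k"
    "loss (trimmed_property W \<theta> D') (\<theta> D) \<le> 2 * loss (\<theta> E) (\<theta> D)"
proof -
  have size_le: "size D \<le> size D' + W" "size D' \<le> size D + W"
    using near size_add_diff_swap[of D D'] by (auto simp: mset_dist_def)
  show ?thesis
  proof (cases "size D' \<le> 3 * W")
    case True
    have "real (size D) \<le> 4 * real W" using size_le True by linarith
    then show ?thesis
      using that[of "{#}"] k True nn by (simp add: trimmed_property_def)
  next
    case False
    then have big: "2 * W < size D" "2 * W < size D'" using size_le by auto
    define lo hi tr where "lo = slice 0 (size D - 2 * W) D" and "hi = slice (2 * W) (size D) D"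
      and "tr = slice W (size D' - W) D'"
    have sub: "lo \<subseteq># D" "hi \<subseteq># D"
      by (simp_all add: lo_def hi_def slice_subset)
    have sz: "real (size lo) \<ge> real (size D) - k" "real (size hi) \<ge> real (size D) - k"
      using big k by (simp_all add: lo_def hi_def size_slice of_nat_diff)
    have data: "lo \<in> datasets R" "hi \<in> datasets R" "tr \<in> datasets R"
      using D D' by (auto simp: lo_def hi_def tr_def intro: datasets_subset slice_subset)
    have between: "\<theta> tr \<in> {min (\<theta> lo) (\<theta> hi)..max (\<theta> lo) (\<theta> hi)}"
      "\<theta> D \<in> {min (\<theta> lo) (\<theta> hi)..max (\<theta> lo) (\<theta> hi)}"
      unfolding lo_def hi_def tr_def
      by (rule monotone_property_between[OF mono data(1,2,3)[unfolded lo_def hi_def tr_def]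
            stoch_dominates_trim_near[OF near big]],
          rule monotone_property_between[OF mono data(1,2)[unfolded lo_def hi_def] D
            stoch_dominates_drop_least[OF big(1)] stoch_dominates_drop_greatest[OF big(1)]])
    have "loss (\<theta> tr) (\<theta> D)
        \<le> 2 * max (loss (min (\<theta> lo) (\<theta> hi)) (\<theta> D)) (loss (max (\<theta> lo) (\<theta> hi)) (\<theta> D))"
      by (rule loss_between[OF nn sym tri below between(2,1)])
    then have "loss (\<theta> tr) (\<theta> D) \<le> 2 * loss (\<theta> lo) (\<theta> D)
        \<or> loss (\<theta> tr) (\<theta> D) \<le> 2 * loss (\<theta> hi) (\<theta> D)"
      by (auto simp: min_def max_def split: if_splits)
    then show ?thesis
      using that sub sz False by (auto simp: trimmed_property_def tr_def)
  qed
qed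

section \<open>The private algorithm and its loss bound\<close>

lemma constant_dp_algorithm:
  "\<epsilon> \<ge> 0 \<Longrightarrow> (\<lambda>D. return borel x) \<in> dp_algorithms R \<epsilon>"
  by (auto simp: dp_algorithms_def prob_space_return measure_return indicator_def)

theorem theorem3:
  fixes R B L \<beta> c \<epsilon> :: real
    and \<theta> :: "real multiset \<Rightarrow> real"
    and loss :: "real \<Rightarrow> real \<Rightarrow> real"
  assumes "R > 0"
    and "monotone_property R \<theta>"
    and "\<And>a b. loss a b \<ge> 0"
    and "\<And>D. D \<in> datasets R \<Longrightarrow> \<theta> D \<in> {-R..R}"
    and "\<And>a b. loss a b = loss b a"
    and "\<And>a b d. loss a d \<le> loss a b + loss b d"
    and "\<And>a. loss a a = 0"
    and "bdd_above {loss (\<theta> D) (\<theta> D') | D D'. D \<in> datasets R \<and> D' \<in> datasets R}"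
    and "B = Sup {loss (\<theta> D) (\<theta> D') | D D'. D \<in> datasets R \<and> D' \<in> datasets R}"
    and "\<And>t t1 t2. t \<ge> t1 \<Longrightarrow> t1 \<ge> t2 \<Longrightarrow> loss t t1 \<le> loss t t2"
    and "\<And>D D'. D \<in> datasets R \<Longrightarrow> D' \<in> datasets R \<Longrightarrow> size D = size D' \<Longrightarrow> D \<noteq> {#} \<Longrightarrow>
           loss (\<theta> D) (\<theta> D') \<le>
             L * (MAX i\<in>{1..size D}. \<bar>ith_largest D i - ith_largest D' i\<bar>)"
    and "\<And>t t1 t2. t1 \<noteq> t2 \<Longrightarrow> loss t t1 \<le> loss t t2 + L * \<bar>t1 - t2\<bar>"
    and "\<beta> > 0"
    and "c = 128 * ln (6 * R * B / (L * \<beta>\<^sup>2))"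
    and "0 < \<epsilon>" and "\<epsilon> < inverse c"
    and "\<epsilon> \<le> 1" and "1 / \<epsilon> \<in> \<nat>"
  shows "\<exists>A\<in>dp_algorithms R (c * \<epsilon>). \<forall>D\<in>datasets R.
           expected_loss loss \<theta> A D
             \<le> ennreal (2 * (exp 1)\<^sup>2) * subset_risk R loss \<theta> D \<epsilon> + ennreal (7 * L * \<beta>)"
proof -
  note mono = assms(2) and nn = assms(3) and range = assms(4) and sym = assms(5)
    and tri = assms(6) and refl = assms(7) and bdd = assms(8) and B_def = assms(9)
    and below = assms(10) and c_def = assms(14)
  have lip: "loss t t1 \<le> loss t t2 + L * \<bar>t1 - t2\<bar>" for t t1 t2
    using assms(12)[of t1 t2 t] by (cases "t1 = t2") auto
  let ?X = "6 * R * B / (L * \<beta>\<^sup>2)"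
  have empty: "{#} \<in> datasets R" by (simp add: datasets_def)
  have L_nn: "L \<ge> 0" using lip[of 0 1 0] nn[of 0 1] refl by auto
  have loss_le_B: "loss (\<theta> D) (\<theta> D') \<le> B" if "D \<in> datasets R" "D' \<in> datasets R" for D D'
    unfolding B_def using that by (intro cSup_upper bdd) auto
  have B_nn: "B \<ge> 0" using loss_le_B[OF empty empty] nn[of "\<theta> {#}" "\<theta> {#}"] by linarith
  have c_pos: "c > 0"
    using \<open>0 < \<epsilon>\<close> \<open>\<epsilon> < inverse c\<close> by (meson less_trans inverse_positive_iff_positive)
  \<comment> \<open>Both \<open>ln 0\<close> and a quotient by 0 are 0 here, so \<open>L = 0\<close>
    or \<open>B = 0\<close> would give \<open>c = 0\<close>.\<close>
  then have "?X \<noteq> 0" unfolding c_def by auto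
  then have pos: "L > 0" "B > 0" using L_nn B_nn by auto
  \<comment> \<open>Measurability comes from the Lipschitz condition, moved to the first argument by
    symmetry.\<close>
  have meas: "(\<lambda>y. loss y a) \<in> borel_measurable borel" for a
  proof (intro borel_measurable_continuous_onI)
    have "L-lipschitz_on UNIV (\<lambda>y. loss y a)"
    proof (rule lipschitz_onI)
      fix x y
      show "dist (loss x a) (loss y a) \<le> L * dist x y"
        using lip[of a x y] lip[of a y x] sym[of a] by (auto simp: dist_real_def abs_minus_commute)
    qed (use L_nn in simp)
    then show "continuous_on UNIV (\<lambda>y. loss y a)" by (rule lipschitz_on_continuous_on)
  qed
  show ?thesis
  \<comment> \<open>If \<open>B\<close> is within the additive error, a constant output suffices.
    Otherwise \<open>B \<le> L * (2 * R)\<close> forces \<open>\<beta>\<close> to be small compared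
    with \<open>R\<close>.\<close>
  proof (cases "B \<le> 7 * L * \<beta>")
    case True
    have "expected_loss loss \<theta> (\<lambda>D. return borel (\<theta> {#})) D \<le> ennreal (7 * L * \<beta>)"
      if "D \<in> datasets R" for D
    proof -
      have "expected_loss loss \<theta> (\<lambda>D. return borel (\<theta> {#})) D = ennreal (loss (\<theta> {#}) (\<theta> D))"
        unfolding expected_loss_def using meas by (subst nn_integral_return) auto
      also have "\<dots> \<le> ennreal (7 * L * \<beta>)"
        using loss_le_B[OF empty that] True by (intro ennreal_leI) linarith
      finally show ?thesis .
    qed
    then show ?thesis
      using constant_dp_algorithm[of "c * \<epsilon>" "\<theta> {#}" R] c_pos \<open>0 < \<epsilon>\<close>
      by (intro bexI[where x = "\<lambda>D. return borel (\<theta> {#})"] ballI add_increasing) auto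
  next
    case False
    have "B \<le> L * (2 * R)"
      unfolding B_def
    proof (rule cSup_least)
      fix x assume "x \<in> {loss (\<theta> D) (\<theta> D') |D D'. D \<in> datasets R \<and> D' \<in> datasets R}"
      then obtain D D' where x: "x = loss (\<theta> D) (\<theta> D')" "D \<in> datasets R" "D' \<in> datasets R"
        by blast
      have "x \<le> L * \<bar>\<theta> D' - \<theta> D\<bar>" using x lip[of "\<theta> D" "\<theta> D'" "\<theta> D"] refl by simp
      also have "\<dots> \<le> L * (2 * R)"
        using range[OF x(2)] range[OF x(3)] L_nn by (intro mult_left_mono) auto
      finally show "x \<le> L * (2 * R)" .
    qed (use empty in auto)
    with False have "L * (7 * \<beta>) < L * (2 * R)" by simp
    then have R_big: "7 * \<beta> < 2 * R" using pos by simp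
    \<comment> \<open>\<open>4 * W \<le> 1 / \<epsilon>\<close> keeps the comparison subsets
      admissible, while \<open>W + 1 \<ge> 1 / (4 * \<epsilon>)\<close> makes failure
      unlikely.\<close>
    define W where "W = nat \<lfloor>1 / (4 * \<epsilon>)\<rfloor>"
    have W: "4 * real W \<le> 1 / \<epsilon>" "1 / (4 * \<epsilon>) \<le> real W + 1"
    proof -
      have "real W = of_int \<lfloor>1 / (4 * \<epsilon>)\<rfloor>" using \<open>0 < \<epsilon>\<close> by (simp add: W_def)
      then have "real W \<le> 1 / (4 * \<epsilon>)" "1 / (4 * \<epsilon>) \<le> real W + 1" by linarith+
      then show "4 * real W \<le> 1 / \<epsilon>" "1 / (4 * \<epsilon>) \<le> real W + 1"
        by auto
    qed
    define h where "h = trimmed_property W \<theta>"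
    define g where "g D = \<beta> * of_int \<lfloor>h D / \<beta>\<rfloor>" for D
    define \<eta> where "\<eta> = c * \<epsilon> / 2"
    have h_value: "\<exists>E\<in>datasets R. h D = \<theta> E" if "D \<in> datasets R" for D
      unfolding h_def trimmed_property_def
      using empty datasets_subset[OF that slice_subset] by auto
    have g_loss: "loss (g D) t \<le> loss (h D) t + L * \<beta>" for D t
    proof -
      have "loss t (g D) \<le> loss t (h D) + L * \<bar>g D - h D\<bar>" by (rule lip)
      also have "\<dots> \<le> loss t (h D) + L * \<beta>"
        using L_nn abs_diff_floor_multiple[OF \<open>\<beta> > 0\<close>, of "h D"]
        by (intro add_left_mono mult_left_mono) (auto simp: g_def)
      finally show ?thesis by (simp add: sym)
    qed
    have g_sub: "g ` datasets R \<subseteq> (\<lambda>x. \<beta> * of_int \<lfloor>x / \<beta>\<rfloor>) ` {-R..R}"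
      using h_value range unfolding g_def by fastforce
    note grid = floor_multiples_of_interval[OF \<open>\<beta> > 0\<close> less_imp_le[OF \<open>R > 0\<close>]]
    have finite_g: "finite (g ` datasets R)" by (rule finite_subset[OF g_sub grid(1)])
    have "real (card (g ` datasets R)) \<le> 2 * R / \<beta> + 2"
      using card_mono[OF grid(1) g_sub] grid(2) by linarith
    also have "\<dots> \<le> 3 * R / \<beta>"
      using R_big \<open>\<beta> > 0\<close> by (simp add: field_simps)
    finally have card_g: "real (card (g ` datasets R)) \<le> 3 * R / \<beta>" .
    have eta: "\<eta> \<ge> 0" using c_pos \<open>0 < \<epsilon>\<close> by (simp add: \<eta>_def)
    obtain A where A: "A \<in> dp_algorithms R (2 * \<eta>)"
      and A_loss: "\<And>D W f a b. D \<in> datasets R \<Longrightarrow>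
        (\<And>D'. D' \<in> datasets R \<Longrightarrow> mset_dist D D' \<le> W \<Longrightarrow> f (g D') \<le> a) \<Longrightarrow>
        (\<And>D'. D' \<in> datasets R \<Longrightarrow> f (g D') \<le> ennreal b) \<Longrightarrow>
        b \<ge> 0 \<Longrightarrow> f \<in> borel_measurable borel \<Longrightarrow>
        (\<integral>\<^sup>+ y. f y \<partial>A D)
          \<le> a + ennreal (real (card (g ` datasets R)) * exp (- \<eta> * (real W + 1)) * b)"
      using inverse_sensitivity_mechanism[OF finite_g eta] by metis
    have X_pos: "?X > 0" using pos \<open>R > 0\<close> \<open>\<beta> > 0\<close> by simp
    have tail: "exp (- \<eta> * (real W + 1)) \<le> inverse ?X"
    proof -
      \<comment> \<open>The left side is \<open>c / 8 = 16 * ln ?X\<close>, which is at least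
        \<open>ln ?X\<close> as \<open>c > 0\<close>.\<close>
      have "\<eta> * (1 / (4 * \<epsilon>)) \<le> \<eta> * (real W + 1)"
        using W(2) eta by (intro mult_left_mono)
      then have "ln ?X \<le> \<eta> * (real W + 1)"
        using \<open>0 < \<epsilon>\<close> c_pos by (simp add: \<eta>_def c_def)
      then have "exp (- \<eta> * (real W + 1)) \<le> exp (- ln ?X)" by simp
      also have "\<dots> = inverse ?X" using X_pos by (simp only: exp_minus exp_ln)
      finally show ?thesis .
    qed
    have fail: "real (card (g ` datasets R)) * exp (- \<eta> * (real W + 1)) * (B + L * \<beta>) \<le> L * \<beta>"
    proof -
      \<comment> \<open>A failure costs at most \<open>B + L * \<beta> \<le> 2 * B\<close>. With at
        most \<open>3 * R / \<beta>\<close> grid values, the factor 6 and the square of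
        \<open>\<beta>\<close> in \<open>?X\<close> make the product exactly
        \<open>L * \<beta>\<close>.\<close>
      have "real (card (g ` datasets R)) * exp (- \<eta> * (real W + 1)) * (B + L * \<beta>)
          \<le> (3 * R / \<beta>) * inverse ?X * (2 * B)"
        using card_g tail False pos \<open>R > 0\<close> \<open>\<beta> > 0\<close> X_pos by (intro mult_mono) auto
      also have "\<dots> = L * \<beta>"
        using pos \<open>R > 0\<close> \<open>\<beta> > 0\<close> by (simp add: field_simps power2_eq_square)
      finally show ?thesis .
    qed
    have "expected_loss loss \<theta> A D
        \<le> ennreal (2 * (exp 1)\<^sup>2) * subset_risk R loss \<theta> D \<epsilon> + ennreal (7 * L * \<beta>)"
      if D: "D \<in> datasets R" for D
    proof -
      let ?r = "ennreal (2 * (exp 1)\<^sup>2) * subset_risk R loss \<theta> D \<epsilon>"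
      have near: "ennreal (loss (g D') (\<theta> D)) \<le> ?r + ennreal (L * \<beta>)"
        if D': "D' \<in> datasets R" "mset_dist D D' \<le> W" for D'
      proof -
        obtain E where E: "E \<subseteq># D" "real (size E) \<ge> real (size D) - 1 / \<epsilon>"
          "loss (h D') (\<theta> D) \<le> 2 * loss (\<theta> E) (\<theta> D)"
          using trimmed_property_near_loss[OF mono nn sym tri below D D' W(1)] unfolding h_def .
        have "ennreal (loss (h D') (\<theta> D)) \<le> ennreal 2 * ennreal (loss (\<theta> E) (\<theta> D))"
          using E(3) nn by (subst ennreal_mult[symmetric]) (auto intro: ennreal_leI)
        also have "\<dots> \<le> ennreal 2 * (ennreal (2 * exp 1) * subset_risk R loss \<theta> D \<epsilon>)"
          by (intro mult_left_mono loss_le_subset_risk[OF D E(1,2) \<open>0 < \<epsilon>\<close> nn sym tri meas]) auto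
        also have "\<dots> = ennreal (4 * exp 1) * subset_risk R loss \<theta> D \<epsilon>"
          unfolding mult.assoc[symmetric] by (subst ennreal_mult[symmetric]) auto
        \<comment> \<open>\<open>4 * e \<le> 2 * e^2\<close> because
          \<open>e \<ge> 2\<close>.\<close>
        also have "\<dots> \<le> ?r"
          using exp_ge_add_one_self[of 1]
          by (intro mult_right_mono ennreal_leI) (auto simp: power2_eq_square)
        finally have "ennreal (loss (h D') (\<theta> D)) \<le> ?r" .
        moreover have "ennreal (loss (g D') (\<theta> D)) \<le> ennreal (loss (h D') (\<theta> D)) + ennreal (L * \<beta>)"
          using g_loss[of D' "\<theta> D"] nn L_nn \<open>\<beta> > 0\<close> by (simp add: ennreal_leI flip: ennreal_plus)
        ultimately show ?thesis by (meson add_right_mono order_trans)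
      qed
      have far: "ennreal (loss (g D') (\<theta> D)) \<le> ennreal (B + L * \<beta>)" if "D' \<in> datasets R" for D'
      proof -
        \<comment> \<open>A rounded value need not be a value of \<open>\<theta>\<close>, but
          \<open>h D'\<close> is one; rounding adds \<open>L * \<beta>\<close>.\<close>
        have "loss (h D') (\<theta> D) \<le> B" using h_value[OF that] loss_le_B D by auto
        then show ?thesis using g_loss[of D' "\<theta> D"] by (intro ennreal_leI) linarith
      qed
      have "expected_loss loss \<theta> A D \<le> ?r + ennreal (L * \<beta>)
          + ennreal (real (card (g ` datasets R)) * exp (- \<eta> * (real W + 1)) * (B + L * \<beta>))"
        unfolding expected_loss_def
        using B_nn L_nn \<open>\<beta> > 0\<close> meas by (intro A_loss D near far) auto
      \<comment> \<open>One \<open>L * \<beta>\<close> stems from rounding and one from failure; the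
        latter is relaxed to reach the constant 7.\<close>
      also have "\<dots> \<le> ?r + ennreal (L * \<beta>) + ennreal (6 * L * \<beta>)"
        using fail mult_nonneg_nonneg[OF L_nn less_imp_le[OF \<open>\<beta> > 0\<close>]]
        by (intro add_left_mono ennreal_leI) simp
      also have "\<dots> = ?r + ennreal (7 * L * \<beta>)"
        using L_nn \<open>\<beta> > 0\<close> by (simp add: add.assoc flip: ennreal_plus)
      finally show ?thesis .
    qed
    then show ?thesis using A by (intro bexI[of _ A]) (auto simp: \<eta>_def)
  qed
qed

end
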